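(* Let $G=(V,E)$ be a finite, connected, simple (undirected) graph. Vicious Trap on $G$ starting from $v\in V$ is a loss for the first player if and only if $v$ is contained in every maximum-cardinality independent set of $G$.
   Context: Vicious Trap: a token starts at an initial vertex $v$ of the graph; two players take turns. On a turn with the token at a vertex $x$, the player must move the token along an edge to a neighbor $w$ of $x$ that has not been visited before (the initial vertex counts as visited) and has not been deleted; in addition, the player may delete any (possibly empty) subset of the other vertices he could have moved to, i.e. of the unvisited, undeleted neighbors of $x$ other than $w$. Moves to deleted vertices are forbidden for the rest of the game. A player who cannot move loses and the other wins. The game is a loss for the first player if the second player has a winning strategy, i.e. a strategy that results in a win whatever the opponent does. An independent set is a set of vertices no two of which are adjacent. *)

theory Defs
  imports "Graph_Theory.Graph_Theory"
begin

text \<open>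
  Finite simple undirected graphs are the symmetric digraphs of the locale \<^locale>\<open>graph\<close>
  (finite, no loops, no parallel arcs): an edge between \<open>u\<close> and \<open>w\<close> is the pair of arcs
  \<open>u \<rightarrow> w\<close> and \<open>w \<rightarrow> u\<close>.
\<close>

definition independent_set :: "('a, 'b) pre_digraph \<Rightarrow> 'a set \<Rightarrow> bool" where
  "independent_set G S \<longleftrightarrow> S \<subseteq> verts G \<and> (\<forall>u\<in>S. \<forall>w\<in>S. \<not> u \<rightarrow>\<^bsub>G\<^esub> w)"

definition maximum_independent_set :: "('a, 'b) pre_digraph \<Rightarrow> 'a set \<Rightarrow> bool" where
  "maximum_independent_set G S \<longleftrightarrow>
     independent_set G S \<and> (\<forall>T. independent_set G T \<longrightarrow> card T \<le> card S)"

record 'a position =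
  token :: 'a
  visited :: "'a set"
  deleted :: "'a set"

text \<open>A move \<open>(w, D)\<close> takes the token to \<open>w\<close> and deletes the vertices in \<open>D\<close>.\<close>

type_synonym 'a move = "'a \<times> 'a set"

definition start_position :: "'a \<Rightarrow> 'a position" where
  "start_position v = \<lparr>token = v, visited = {v}, deleted = {}\<rparr>"

definition targets :: "('a, 'b) pre_digraph \<Rightarrow> 'a position \<Rightarrow> 'a set" where
  "targets G p = {w. token p \<rightarrow>\<^bsub>G\<^esub> w \<and> w \<notin> visited p \<and> w \<notin> deleted p}"

definition legal_move :: "('a, 'b) pre_digraph \<Rightarrow> 'a position \<Rightarrow> 'a move \<Rightarrow> bool" where
  "legal_move G p m \<longleftrightarrow> fst m \<in> targets G p \<and> snd m \<subseteq> targets G p - {fst m}"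

definition make_move :: "'a position \<Rightarrow> 'a move \<Rightarrow> 'a position" where
  "make_move p m =
     \<lparr>token = fst m, visited = insert (fst m) (visited p), deleted = deleted p \<union> snd m\<rparr>"

text \<open>Plays are lists of moves in chronological order.\<close>

definition position_after :: "'a \<Rightarrow> 'a move list \<Rightarrow> 'a position" where
  "position_after v ms = foldl make_move (start_position v) ms"

definition legal_play :: "('a, 'b) pre_digraph \<Rightarrow> 'a \<Rightarrow> 'a move list \<Rightarrow> bool" where
  "legal_play G v ms \<longleftrightarrow>
     (\<forall>i<length ms. legal_move G (position_after v (take i ms)) (ms ! i))"

text \<open>
  On a finite graph every play can be prolonged to a complete one after finitely many moves,
  since each move visits a new vertex; so only finite plays need to be considered.
\<close>

definition complete_play :: "('a, 'b) pre_digraph \<Rightarrow> 'a \<Rightarrow> 'a move list \<Rightarrow> bool" where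
  "complete_play G v ms \<longleftrightarrow>
     legal_play G v ms \<and> (\<nexists>m. legal_move G (position_after v ms) m)"

datatype player = First | Second

fun opponent :: "player \<Rightarrow> player" where
  "opponent First = Second"
| "opponent Second = First"

definition player_to_move :: "'a move list \<Rightarrow> player" where
  "player_to_move ms = (if even (length ms) then First else Second)"

text \<open>Meaningful for complete plays, where the player to move is stuck and loses.\<close>

definition winner :: "'a move list \<Rightarrow> player" where
  "winner ms = opponent (player_to_move ms)"

text \<open>A strategy chooses the next move from the moves made so far by both players.\<close>

type_synonym 'a strategy = "'a move list \<Rightarrow> 'a move"

definition consistent_with :: "player \<Rightarrow> 'a strategy \<Rightarrow> 'a move list \<Rightarrow> bool" where
  "consistent_with P \<sigma> ms \<longleftrightarrow>
     (\<forall>i<length ms. player_to_move (take i ms) = P \<longrightarrow> ms ! i = \<sigma> (take i ms))"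

text \<open>
  The first conjunct says that \<open>\<sigma>\<close> prescribes a legal move whenever its player can move. Without
  it, a strategy prescribing illegal moves would be winning for want of complete plays
  consistent with it.
\<close>

definition winning_strategy ::
    "('a, 'b) pre_digraph \<Rightarrow> 'a \<Rightarrow> player \<Rightarrow> 'a strategy \<Rightarrow> bool" where
  "winning_strategy G v P \<sigma> \<longleftrightarrow>
     (\<forall>ms. legal_play G v ms \<and> consistent_with P \<sigma> ms \<and> player_to_move ms = P \<and>
           (\<exists>m. legal_move G (position_after v ms) m)
        \<longrightarrow> legal_move G (position_after v ms) (\<sigma> ms)) \<and>
     (\<forall>ms. complete_play G v ms \<and> consistent_with P \<sigma> ms \<longrightarrow> winner ms = P)"

definition first_player_loses :: "('a, 'b) pre_digraph \<Rightarrow> 'a \<Rightarrow> bool" where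
  "first_player_loses G v \<longleftrightarrow> (\<exists>\<sigma>. winning_strategy G v Second \<sigma>)"

end

theory Submission
  imports Defs
begin

text \<open>
  Let \<open>\<alpha>(A)\<close> be the largest size of an independent set contained in \<open>A\<close>, let \<open>x\<close> be the vertex of
  the token and \<open>U\<close> the set of vertices still available, so that a vertex belongs to every maximum
  independent set of the graph induced on \<open>U \<union> {x}\<close> iff dropping it lowers \<open>\<alpha>\<close>. The claim is that the
  player to move loses iff this holds for \<open>x\<close>, that is, iff \<open>\<alpha>(U) < \<alpha>(U \<union> {x})\<close>; call the token
  essential then. The theorem is the case of the start position.

  Suppose that the token is essential. A maximum independent set of \<open>U \<union> {x}\<close> then contains \<open>x\<close>, so
  it contains no neighbour of \<open>x\<close>, and without \<open>x\<close> it is an independent set of size \<open>\<alpha>(U)\<close> that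
  survives every move, because a move only removes neighbours of \<open>x\<close>. So after the move the available
  vertices already attain the maximum, and the new token is not essential
  (\<open>legal_move_leaves_essential_token\<close>).

  Suppose that the token is not essential, and let \<open>N\<close> be the neighbours of \<open>x\<close> in \<open>U\<close>. Adding \<open>x\<close> to
  an independent subset of \<open>U - N\<close> shows \<open>\<alpha>(U - N) < \<alpha>(U \<union> {x}) = \<alpha>(U)\<close>. Put the vertices of \<open>N\<close>
  back one at a time: some vertex \<open>w\<close> is the first to raise \<open>\<alpha>\<close>. Moving to \<open>w\<close> while deleting the vertices
  not yet put back makes the new token essential (\<open>legal_move_to_essential_token\<close>). In particular a
  player who is stuck has an essential token.

  Hence the player who wins the start position by this criterion has a winning strategy, namely always
  to hand over an essential token. That player is unique, since following two winning strategies
  against each other to the end would give a play won by both (\<open>not_both_winning\<close>).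
\<close>

section \<open>Independence numbers of vertex subsets\<close>

definition independence_number :: "('a, 'b) pre_digraph \<Rightarrow> 'a set \<Rightarrow> nat" where
  "independence_number G A = Max (card ` {S. independent_set G S \<and> S \<subseteq> A})"

context graph
begin

lemma finite_independent_sets: "finite {S. independent_set G S \<and> S \<subseteq> A}"
  by (rule finite_subset[of _ "Pow (verts G)"]) (auto simp: independent_set_def)

lemma card_le_independence_number:
  assumes "independent_set G S" and "S \<subseteq> A"
  shows "card S \<le> independence_number G A"
  unfolding independence_number_def using assms finite_independent_sets by (intro Max_ge) auto

lemma obtain_largest_independent_subset:
  obtains S where "independent_set G S" and "S \<subseteq> A" and "card S = independence_number G A"
proof -
  have "{} \<in> {S. independent_set G S \<and> S \<subseteq> A}"
    by (simp add: independent_set_def)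
  then have "independence_number G A \<in> card ` {S. independent_set G S \<and> S \<subseteq> A}"
    unfolding independence_number_def using finite_independent_sets by (intro Max_in) auto
  then show thesis using that by auto
qed

lemma independence_number_mono:
  assumes "A \<subseteq> B"
  shows "independence_number G A \<le> independence_number G B"
  using assms by (metis card_le_independence_number obtain_largest_independent_subset subset_trans)

lemma independent_set_finite: "independent_set G S \<Longrightarrow> finite S"
  unfolding independent_set_def using finite_verts finite_subset by blast

lemma independent_set_insert:
  assumes "independent_set G S" and "x \<in> verts G" and "\<And>y. y \<in> S \<Longrightarrow> \<not> x \<rightarrow>\<^bsub>G\<^esub> y"
  shows "independent_set G (insert x S)"
  using assms arcs_ends_symmetric[OF sym_arcs] by (auto simp: independent_set_def dest: adj_not_same)

lemma in_all_maximum_independent_sets_iff: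
  assumes "v \<in> verts G"
  shows "(\<forall>S. maximum_independent_set G S \<longrightarrow> v \<in> S) \<longleftrightarrow>
    independence_number G (verts G - {v}) < independence_number G (verts G)"
proof -
  have maximum_iff: "maximum_independent_set G S \<longleftrightarrow>
      independent_set G S \<and> card S = independence_number G (verts G)" for S
    unfolding maximum_independent_set_def
    by (metis card_le_independence_number independent_set_def le_antisym
        obtain_largest_independent_subset)
  show ?thesis
  proof
    assume in_all: "\<forall>S. maximum_independent_set G S \<longrightarrow> v \<in> S"
    obtain S where S: "independent_set G S" "S \<subseteq> verts G - {v}"
        "card S = independence_number G (verts G - {v})"
      by (rule obtain_largest_independent_subset)
    then have "card S \<noteq> independence_number G (verts G)"
      using in_all maximum_iff by blast
    then show "independence_number G (verts G - {v}) < independence_number G (verts G)"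
      using S independence_number_mono[of "verts G - {v}" "verts G"] by auto
  next
    assume less: "independence_number G (verts G - {v}) < independence_number G (verts G)"
    show "\<forall>S. maximum_independent_set G S \<longrightarrow> v \<in> S"
    proof (intro allI impI, rule ccontr)
      fix S assume S: "maximum_independent_set G S" "v \<notin> S"
      then have "S \<subseteq> verts G - {v}"
        by (auto simp: maximum_iff independent_set_def)
      then have "card S \<le> independence_number G (verts G - {v})"
        and "card S = independence_number G (verts G)"
        using S maximum_iff card_le_independence_number by blast+
      with less show False by simp
    qed
  qed
qed

end

section \<open>Positions lost for the player to move\<close>

definition available :: "('a, 'b) pre_digraph \<Rightarrow> 'a position \<Rightarrow> 'a set" where
  "available G p = verts G - visited p - deleted p"

definition essential_token :: "('a, 'b) pre_digraph \<Rightarrow> 'a position \<Rightarrow> bool" where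
  "essential_token G p \<longleftrightarrow>
     independence_number G (available G p)
       < independence_number G (insert (token p) (available G p))"

context graph
begin

lemma targets_eq: "targets G p = {w \<in> available G p. token p \<rightarrow>\<^bsub>G\<^esub> w}"
  by (auto simp: targets_def available_def)

lemma available_make_move: "available G (make_move p m) = available G p - insert (fst m) (snd m)"
  by (auto simp: available_def make_move_def)

lemma token_make_move: "token (make_move p m) = fst m"
  by (simp add: make_move_def)

lemma legal_move_leaves_essential_token:
  assumes essential: "essential_token G p" and legal: "legal_move G p m"
  shows "\<not> essential_token G (make_move p m)"
proof -
  define x where "x = token p"
  define U where "U = available G p"
  define U' where "U' = available G (make_move p m)"
  have neighbours: "fst m \<in> U" "\<And>y. y \<in> insert (fst m) (snd m) \<Longrightarrow> x \<rightarrow>\<^bsub>G\<^esub> y"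
    using legal by (auto simp: legal_move_def targets_eq U_def x_def)
  have U': "U' = U - insert (fst m) (snd m)"
    by (simp add: U'_def U_def available_make_move)
  have less: "independence_number G U < independence_number G (insert x U)"
    using essential by (simp add: essential_token_def x_def U_def)
  obtain S where S: "independent_set G S" "S \<subseteq> insert x U"
      "card S = independence_number G (insert x U)"
    by (rule obtain_largest_independent_subset)
  have "x \<in> S"
    using S less card_le_independence_number[of S U] by fastforce
  have "S - {x} \<subseteq> U'"
    using S(1,2) \<open>x \<in> S\<close> neighbours(2) unfolding U' independent_set_def by blast
  moreover have "independent_set G (S - {x})"
    using S by (auto simp: independent_set_def)
  ultimately have "card (S - {x}) \<le> independence_number G U'"
    by (intro card_le_independence_number)
  then have "independence_number G U \<le> independence_number G U'"
    using S \<open>x \<in> S\<close> less independent_set_finite by simp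
  moreover have "independence_number G (insert (fst m) U') \<le> independence_number G U"
    using neighbours by (intro independence_number_mono) (auto simp: U')
  ultimately show ?thesis
    by (simp add: essential_token_def token_make_move flip: U'_def)
qed

text \<open>
  Instead of an order in which the neighbours are put back, the proof takes a smallest set \<open>T\<close> of
  neighbours whose return raises the independence number; any element of \<open>T\<close> can then be the one that
  comes last.
\<close>

lemma legal_move_to_essential_token:
  assumes inessential: "\<not> essential_token G p"
    and token: "token p \<in> verts G" "token p \<in> visited p"
  obtains m where "legal_move G p m" and "essential_token G (make_move p m)"
proof -
  define x where "x = token p"
  define U where "U = available G p"
  define N where "N = targets G p"
  have N: "N \<subseteq> U" "\<And>y. y \<in> N \<longleftrightarrow> y \<in> U \<and> x \<rightarrow>\<^bsub>G\<^esub> y"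
    by (auto simp: N_def U_def x_def targets_eq)
  have "finite N"
    using N(1) finite_verts by (auto simp: U_def available_def intro: finite_subset)
  have "x \<notin> U"
    using token by (simp add: x_def U_def available_def)
  let ?raises = "\<lambda>T. T \<subseteq> N \<and>
    independence_number G (U - N) < independence_number G (U - N \<union> T)"
  have "?raises N"
  proof -
    obtain S where S: "independent_set G S" "S \<subseteq> U - N"
        "card S = independence_number G (U - N)"
      by (rule obtain_largest_independent_subset)
    have "independent_set G (insert x S)"
      using S N token by (intro independent_set_insert) (auto simp: x_def)
    then have "card (insert x S) \<le> independence_number G (insert x U)"
      using S by (intro card_le_independence_number) auto
    moreover have "card (insert x S) = Suc (card S)"
      using S \<open>x \<notin> U\<close> independent_set_finite by (intro card_insert_disjoint) auto
    moreover have "independence_number G (insert x U) \<le> independence_number G U"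
      using inessential by (simp add: essential_token_def x_def U_def)
    ultimately show ?thesis
      using S N by (simp add: Un_absorb2)
  qed
  then obtain T where T: "?raises T" and smallest: "\<And>T'. ?raises T' \<Longrightarrow> card T \<le> card T'"
    using ex_has_least_nat[of ?raises N card] by blast
  have "T \<noteq> {}"
    using T by auto
  then obtain w where "w \<in> T"
    by blast
  have "card (T - {w}) < card T"
    using \<open>w \<in> T\<close> T \<open>finite N\<close> by (meson card_Diff1_less finite_subset)
  then have "\<not> ?raises (T - {w})"
    using smallest by (meson not_le)
  then have less: "independence_number G (U - N \<union> (T - {w})) < independence_number G (U - N \<union> T)"
    using T by auto
  have "available G (make_move p (w, N - T)) = U - N \<union> (T - {w})"
    using T N \<open>w \<in> T\<close> by (auto simp: available_make_move simp flip: U_def)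
  moreover have "insert w (U - N \<union> (T - {w})) = U - N \<union> T"
    using \<open>w \<in> T\<close> by auto
  ultimately have "essential_token G (make_move p (w, N - T))"
    using less by (simp add: essential_token_def token_make_move)
  moreover have "legal_move G p (w, N - T)"
    using T \<open>w \<in> T\<close> by (auto simp: legal_move_def simp flip: N_def)
  ultimately show thesis
    using that by blast
qed

end

section \<open>Plays\<close>

lemma position_after_Nil [simp]: "position_after v [] = start_position v"
  by (simp add: position_after_def)

lemma position_after_snoc [simp]:
  "position_after v (ms @ [m]) = make_move (position_after v ms) m"
  by (simp add: position_after_def)

lemma legal_play_Nil [simp]: "legal_play G v []"
  by (simp add: legal_play_def)

lemma legal_play_snoc [simp]:
  "legal_play G v (ms @ [m]) \<longleftrightarrow> legal_play G v ms \<and> legal_move G (position_after v ms) m"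
  by (auto simp: legal_play_def less_Suc_eq nth_append)

lemma consistent_with_Nil [simp]: "consistent_with P \<sigma> []"
  by (simp add: consistent_with_def)

lemma consistent_with_snoc [simp]:
  "consistent_with P \<sigma> (ms @ [m]) \<longleftrightarrow>
     consistent_with P \<sigma> ms \<and> (player_to_move ms = P \<longrightarrow> m = \<sigma> ms)"
  by (auto simp: consistent_with_def less_Suc_eq nth_append)

lemma player_to_move_Nil [simp]: "player_to_move [] = First"
  by (simp add: player_to_move_def)

lemma player_to_move_snoc [simp]: "player_to_move (ms @ [m]) = opponent (player_to_move ms)"
  by (simp add: player_to_move_def)

lemma opponent_eq_iff: "opponent P = Q \<longleftrightarrow> P \<noteq> Q"
  by (cases P; cases Q) auto

context graph
begin

lemma token_of_legal_play:
  assumes "v \<in> verts G" and "legal_play G v ms"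
  shows "token (position_after v ms) \<in> verts G \<inter> visited (position_after v ms)"
  using assms(2)
proof (induction ms rule: rev_induct)
  case Nil
  then show ?case using assms(1) by (simp add: start_position_def)
next
  case (snoc m ms)
  then show ?case
    by (auto simp: make_move_def legal_move_def targets_eq available_def)
qed

text \<open>Bounds the length of legal plays, so that longest ones exist.\<close>

lemma length_of_legal_play:
  assumes "legal_play G v ms"
  shows "length ms + card (available G (position_after v ms)) \<le> card (verts G)"
  using assms
proof (induction ms rule: rev_induct)
  case Nil
  then show ?case by (auto simp: available_def intro: card_mono)
next
  case (snoc m ms)
  let ?p = "position_after v ms"
  have "available G (make_move ?p m) \<subset> available G ?p"
    using snoc.prems by (auto simp: available_make_move legal_move_def targets_eq)
  moreover have "finite (available G ?p)"
    by (simp add: available_def)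
  ultimately have "card (available G (make_move ?p m)) < card (available G ?p)"
    by (rule psubset_card_mono[rotated])
  then show ?case using snoc by simp
qed

text \<open>
  A longest play that follows both strategies is complete: otherwise the player to move could
  prolong it by the prescribed move.
\<close>

lemma not_both_winning:
  assumes first: "winning_strategy G v First \<sigma>" and second: "winning_strategy G v Second \<tau>"
  shows False
proof -
  let ?follows = "\<lambda>ms. legal_play G v ms \<and> consistent_with First \<sigma> ms
    \<and> consistent_with Second \<tau> ms"
  have "?follows []"
    by simp
  moreover have "\<forall>ms. ?follows ms \<longrightarrow> length ms < Suc (card (verts G))"
    using length_of_legal_play by fastforce
  ultimately obtain ms where ms: "?follows ms"
    and longest: "\<And>ms'. ?follows ms' \<Longrightarrow> length ms' \<le> length ms"
    using ex_has_greatest_nat[of ?follows "[]" length] by blast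
  have "complete_play G v ms"
  proof (rule ccontr)
    assume "\<not> complete_play G v ms"
    then have movable: "\<exists>m. legal_move G (position_after v ms) m"
      using ms by (simp add: complete_play_def)
    define m where "m = (case player_to_move ms of First \<Rightarrow> \<sigma> ms | Second \<Rightarrow> \<tau> ms)"
    have "legal_move G (position_after v ms) m"
      using ms movable first second
      by (cases "player_to_move ms") (auto simp: m_def winning_strategy_def)
    then have "?follows (ms @ [m])"
      using ms by (auto simp: m_def)
    from longest[OF this] show False by simp
  qed
  then have "winner ms = First" and "winner ms = Second"
    using ms first second unfolding winning_strategy_def by blast+
  then show False by simp
qed

end

section \<open>The strategy of handing over an essential token\<close>

definition hand_over_essential_token :: "('a, 'b) pre_digraph \<Rightarrow> 'a \<Rightarrow> 'a strategy" where
  "hand_over_essential_token G v ms =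
     (SOME m. legal_move G (position_after v ms) m \<and>
              essential_token G (make_move (position_after v ms) m))"

context graph
begin

lemma hand_over_essential_token:
  assumes "v \<in> verts G" and "legal_play G v ms" and "\<not> essential_token G (position_after v ms)"
  shows "legal_move G (position_after v ms) (hand_over_essential_token G v ms)"
    and "essential_token G (make_move (position_after v ms) (hand_over_essential_token G v ms))"
proof -
  have "\<exists>m. legal_move G (position_after v ms) m \<and>
      essential_token G (make_move (position_after v ms) m)"
    using assms token_of_legal_play[of v ms] by (metis IntD1 IntD2 legal_move_to_essential_token)
  from someI_ex[OF this]
  show "legal_move G (position_after v ms) (hand_over_essential_token G v ms)"
    and "essential_token G (make_move (position_after v ms) (hand_over_essential_token G v ms))"
    by (simp_all add: hand_over_essential_token_def)
qed

text \<open>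
  The invariant of a play that follows the strategy is that the opponent always faces an essential
  token and \<open>P\<close> never does. Since an inessential token can always be moved, \<open>P\<close> is never stuck, so
  only the opponent can lose.
\<close>

lemma hand_over_essential_token_wins:
  assumes v: "v \<in> verts G"
    and start: "essential_token G (start_position v) \<longleftrightarrow> P = Second"
  shows "winning_strategy G v P (hand_over_essential_token G v)"
proof -
  let ?\<sigma> = "hand_over_essential_token G v"
  have essential_iff:
    "essential_token G (position_after v ms) \<longleftrightarrow> player_to_move ms \<noteq> P"
    if "legal_play G v ms" and "consistent_with P ?\<sigma> ms" for ms
    using that
  proof (induction ms rule: rev_induct)
    case Nil
    then show ?case using start by (cases P) auto
  next
    case (snoc m ms)
    show ?case
    proof (cases "player_to_move ms = P")
      case True
      then show ?thesis
        using snoc hand_over_essential_token(2)[OF v, of ms] by (simp add: opponent_eq_iff)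
    next
      case False
      then show ?thesis
        using snoc legal_move_leaves_essential_token by (simp add: opponent_eq_iff)
    qed
  qed
  have "legal_move G (position_after v ms) (?\<sigma> ms)"
    if "legal_play G v ms" "consistent_with P ?\<sigma> ms" "player_to_move ms = P" for ms
    using that essential_iff hand_over_essential_token(1)[OF v] by blast
  then show ?thesis
    unfolding winning_strategy_def complete_play_def winner_def opponent_eq_iff by blast
qed

lemma first_player_loses_iff_essential_token:
  assumes "v \<in> verts G"
  shows "first_player_loses G v \<longleftrightarrow> essential_token G (start_position v)"
proof
  show "first_player_loses G v" if "essential_token G (start_position v)"
    using that hand_over_essential_token_wins[OF assms, of Second]
    by (auto simp: first_player_loses_def)
next
  assume "first_player_loses G v"
  then show "essential_token G (start_position v)"
    using hand_over_essential_token_wins[OF assms, of First] not_both_winning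
    unfolding first_player_loses_def by blast
qed

end

section \<open>Solution of the game\<close>

theorem proposition5:
  fixes G :: "('a, 'b) pre_digraph" and v :: 'a
  assumes "graph G" and "connected G" and "v \<in> verts G"
  shows "first_player_loses G v \<longleftrightarrow> (\<forall>S. maximum_independent_set G S \<longrightarrow> v \<in> S)"
proof -
  interpret graph G by (rule assms(1))
  have "available G (start_position v) = verts G - {v}"
    and "insert v (verts G - {v}) = verts G"
    using assms(3) by (auto simp: available_def start_position_def)
  then have "essential_token G (start_position v) \<longleftrightarrow>
      independence_number G (verts G - {v}) < independence_number G (verts G)"
    by (simp add: essential_token_def start_position_def)
  then show ?thesis
    using first_player_loses_iff_essential_token in_all_maximum_independent_sets_iff assms(3)
    by simp
qed

end
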